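(* $\pi(K_{n,n}\square K_{n,n})\le\left(\frac{3}{2}+o(1)\right)n^2$ as $n\to\infty$; that is, $\limsup_{n\to\infty}\pi(K_{n,n}\square K_{n,n})/n^2\le \frac32$.
   Context: $K_{n,n}$ is the complete bipartite graph with both parts of size $n$. For graphs $G,H$, the Cartesian product $G\square H$ has vertex set $V(G)\times V(H)$, with $(g,h)\sim(g',h')$ iff ($g=g'$ and $hh'\in E(H)$) or ($h=h'$ and $gg'\in E(G)$). A vertex coloring $c$ of a graph is non-repetitive if there is no path $v_1,\dots,v_{2k}$ ($k\ge1$, distinct vertices, consecutive ones adjacent) with $c(v_i)=c(v_{k+i})$ for all $1\le i\le k$; $\pi(G)$ denotes the minimum number of colors in a non-repetitive coloring of $G$. *)

theory Defs
  imports
    "HOL-Library.Extended_Real"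
    "HOL-Library.Liminf_Limsup"
    "HOL-Library.FuncSet"
    "Graph_Theory.Vertex_Walk"
    "Graph_Theory.Kuratowski"
begin

(* Undirected simple graphs are finite, symmetric, loop-free pair digraphs (locale pair_graph),
   so every edge is represented by its two opposite arcs. *)

definition complete_bipartite :: "nat \<Rightarrow> nat \<Rightarrow> (nat + nat) pair_pre_digraph" where
  "complete_bipartite m n =
     \<lparr> pverts = Inl ` {..<m} \<union> Inr ` {..<n},
       parcs = (Inl ` {..<m}) \<times> (Inr ` {..<n}) \<union> (Inr ` {..<n}) \<times> (Inl ` {..<m}) \<rparr>"

definition cartesian_prod ::
    "'a pair_pre_digraph \<Rightarrow> 'b pair_pre_digraph \<Rightarrow> ('a \<times> 'b) pair_pre_digraph"
    (infixr \<open>\<box>\<close> 70) where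
  "G \<box> H =
     \<lparr> pverts = pverts G \<times> pverts H,
       parcs = {((g, h), (g', h')) | g h g' h'.
                  (g, h) \<in> pverts G \<times> pverts H \<and> (g', h') \<in> pverts G \<times> pverts H \<and>
                  (g = g' \<and> (h, h') \<in> parcs H \<or> h = h' \<and> (g, g') \<in> parcs G)} \<rparr>"

definition nonrepetitive :: "'a pair_pre_digraph \<Rightarrow> ('a \<Rightarrow> 'c) \<Rightarrow> bool" where
  "nonrepetitive G c \<longleftrightarrow>
     \<not> (\<exists>p k. k \<ge> 1 \<and> length p = 2 * k \<and> vpath p (with_proj G) \<and>
            (\<forall>i<k. c (p ! i) = c (p ! (k + i))))"

(* Meaningful for finite graphs only: there the minimum is attained, see
   nonrepetitive_number_attained below. *)
definition nonrepetitive_number :: "'a pair_pre_digraph \<Rightarrow> nat" where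
  "nonrepetitive_number G =
     (LEAST k. \<exists>c :: 'a \<Rightarrow> nat. c \<in> pverts G \<rightarrow> {..<k} \<and> nonrepetitive G c)"

lemma complete_bipartite_digraph_complete_bipartite:
  "complete_bipartite_digraph m n (with_proj (complete_bipartite m n))"
  unfolding complete_bipartite_digraph_pair_def
proof (intro conjI exI)
  show "pverts (complete_bipartite m n) = Inl ` {..<m} \<union> Inr ` {..<n}"
    by (simp add: complete_bipartite_def)
qed (auto simp: complete_bipartite_def card_image)

lemma pair_graph_cartesian_prod:
  assumes "pair_graph G" "pair_graph H"
  shows "pair_graph (G \<box> H)"
proof -
  interpret G: pair_graph G by fact
  interpret H: pair_graph H by fact
  have fin: "finite (pverts G \<times> pverts H)"
    using G.pair_finite_verts H.pair_finite_verts by simp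
  have sub: "parcs (G \<box> H) \<subseteq> (pverts G \<times> pverts H) \<times> (pverts G \<times> pverts H)"
    by (auto simp: cartesian_prod_def)
  have "finite (parcs (G \<box> H))"
    using finite_subset[OF sub] fin by blast
  moreover have "sym (parcs G)" "sym (parcs H)"
    using G.pair_sym_arcs H.pair_sym_arcs by (simp_all add: symmetric_def)
  then have "sym (parcs (G \<box> H))"
    unfolding sym_def cartesian_prod_def by auto
  ultimately show ?thesis
    using fin
    by unfold_locales
      (auto simp: cartesian_prod_def symmetric_def dest: G.pair_no_loops H.pair_no_loops)
qed

lemma nonrepetitive_if_inj_on:
  assumes "inj_on c (pverts G)"
  shows "nonrepetitive G c"
  unfolding nonrepetitive_def
proof (intro notI, elim exE conjE)
  fix p and k :: nat
  assume k: "k \<ge> 1" and len: "length p = 2 * k" and p: "vpath p (with_proj G)"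
    and rep: "\<forall>i<k. c (p ! i) = c (p ! (k + i))"
  have "set p \<subseteq> pverts G" and dist: "distinct p"
    using p by (auto simp: vpath_def vwalk_def)
  then have "p ! 0 \<in> pverts G" "p ! k \<in> pverts G"
    using k len by (auto simp: subset_iff)
  moreover have "c (p ! 0) = c (p ! k)"
    using rep k by (metis Nat.add_0_right less_eq_Suc_le One_nat_def)
  ultimately have "p ! 0 = p ! k"
    using assms by (auto dest: inj_onD)
  then show False
    using dist k len by (simp add: nth_eq_iff_index_eq)
qed

lemma nonrepetitive_number_attained:
  assumes "finite (pverts G)"
  shows "\<exists>c. c \<in> pverts G \<rightarrow> {..<nonrepetitive_number G} \<and> nonrepetitive G c"
proof -
  obtain c :: "'a \<Rightarrow> nat" where "bij_betw c (pverts G) {..<card (pverts G)}"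
    using ex_bij_betw_finite_nat[OF assms] by (auto simp: atLeast0LessThan)
  then have "\<exists>c :: 'a \<Rightarrow> nat. c \<in> pverts G \<rightarrow> {..<card (pverts G)} \<and> nonrepetitive G c"
    by (auto simp: bij_betw_def intro: nonrepetitive_if_inj_on)
  then show ?thesis
    unfolding nonrepetitive_number_def by (rule LeastI)
qed

end

theory Submission
  imports Defs "HOL-Number_Theory.Cong"
begin

text \<open>In \<open>complete_bipartite n n \<box> complete_bipartite n n\<close> give the vertices of one of the four
  \<open>n \<times> n\<close> blocks pairwise distinct colors, so that no repetition meets this block. Color the opposite
  block, a matrix of cells, by a Latin square with \<open>n\<close> colors. A vertex of a remaining block is
  adjacent either to all cells of one row or to all cells of one column; color it by that line, which
  costs \<open>2 n\<close> colors. If two line vertices have the same color, neighboring cells of the same color lie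
  on one line and are equal by the Latin property. Since a repetition of length at least 4 starts with
  two disjoint arcs of the same color pattern, there is none. This uses only \<open>n\<^sup>2 + 3 n\<close> colors.\<close>

lemma vwalk_nth_arc:
  assumes "vwalk p G" "Suc i < length p"
  shows "(p ! i, p ! Suc i) \<in> arcs_ends G"
proof -
  have "(p ! i, p ! Suc i) \<in> set (vwalk_arcs p)"
    using assms(2)
  proof (induction p arbitrary: i rule: vwalk_arcs.induct)
    case (3 u v p)
    then show ?case by (cases i) auto
  qed auto
  then show ?thesis
    using assms(1) by (auto simp: vwalk_def)
qed

text \<open>For \<open>k = 1\<close> the repetition is a single arc, which \<open>proper\<close>
  excludes. For \<open>k \<ge> 2\<close> each half begins with an arc; the two arcs have equal
  colors, so \<open>sep\<close> makes the path revisit a vertex.\<close>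

lemma nonrepetitive_if_arc_colors_separated:
  assumes proper: "\<And>u v. (u, v) \<in> parcs G \<Longrightarrow> c u \<noteq> c v"
    and sep: "\<And>u v u' v'. \<lbrakk>(u, v) \<in> parcs G; (u', v') \<in> parcs G; c u = c u'; c v = c v'\<rbrakk>
      \<Longrightarrow> u = u' \<or> v = v'"
  shows "nonrepetitive G c"
  unfolding nonrepetitive_def
proof (intro notI, elim exE conjE)
  fix p and k :: nat
  assume k: "k \<ge> 1" and len: "length p = 2 * k" and p: "vpath p (with_proj G)"
    and rep: "\<forall>i<k. c (p ! i) = c (p ! (k + i))"
  have dist: "distinct p"
    using p by (simp add: vpath_def)
  have arc: "(p ! i, p ! Suc i) \<in> parcs G" if "Suc i < 2 * k" for i
    using p that len vwalk_nth_arc[of p "with_proj G" i] by (auto simp: vpath_def)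
  have rep0: "c (p ! 0) = c (p ! k)"
    using rep[rule_format, of 0] k by simp
  show False
  proof (cases "k = 1")
    case True
    then show False
      using rep0 proper arc[of 0] by simp
  next
    case False
    then have k2: "k \<ge> 2"
      using k by simp
    then have "c (p ! Suc 0) = c (p ! Suc k)"
      using rep[rule_format, of "Suc 0"] by simp
    then have "p ! 0 = p ! k \<or> p ! Suc 0 = p ! Suc k"
      using sep[OF arc[of 0] arc[of k]] rep0 k2 by simp
    then show False
      using dist len k2 by (auto simp: nth_eq_iff_index_eq)
  qed
qed

text \<open>The Latin square is the addition table of the integers mod \<open>n\<close>. The offsets
  keep the color ranges of the four blocks disjoint.\<close>

fun block_coloring :: "nat \<Rightarrow> (nat + nat) \<times> (nat + nat) \<Rightarrow> nat" where
  "block_coloring n (Inr i, Inr j) = (i + j) mod n"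
| "block_coloring n (Inl i, Inr j) = n + j"
| "block_coloring n (Inr i, Inl j) = 2 * n + i"
| "block_coloring n (Inl i, Inl j) = 3 * n + (i * n + j)"

lemma add_mod_eq_iff:
  fixes i j k n :: nat
  assumes "j < n" "k < n"
  shows "(i + j) mod n = (i + k) mod n \<longleftrightarrow> j = k"
    and "(j + i) mod n = (k + i) mod n \<longleftrightarrow> j = k"
  using assms cong_add_lcancel_nat[of i j k n] cong_add_rcancel_nat[of j i k n]
  by (simp_all add: cong_def)

lemma mult_add_less_square:
  fixes i j n :: nat
  assumes "i < n" "j < n"
  shows "i * n + j < n\<^sup>2"
proof -
  have "i * n + j < Suc i * n"
    using assms by simp
  also have "\<dots> \<le> n * n"
    using assms by (intro mult_le_mono1) simp
  finally show ?thesis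
    by (simp add: power2_eq_square)
qed

text \<open>Uniqueness of base-\<open>n\<close> digits, which makes the colors of the
  \<open>(Inl, Inl)\<close> block distinct.\<close>

lemma mult_add_eq_iff:
  fixes i j i' j' n :: nat
  assumes "j < n" "j' < n"
  shows "i * n + j = i' * n + j' \<longleftrightarrow> i = i' \<and> j = j'"
proof
  assume eq: "i * n + j = i' * n + j'"
  have "(i * n + j) div n = i" "(i' * n + j') div n = i'"
    using assms by auto
  with eq show "i = i' \<and> j = j'"
    by simp
qed simp

lemma block_coloring_eqD:
  assumes "u \<in> pverts (complete_bipartite n n \<box> complete_bipartite n n)"
    and "v \<in> pverts (complete_bipartite n n \<box> complete_bipartite n n)"
    and "block_coloring n u = block_coloring n v"
  shows "u = v
    \<or> (\<exists>i j i' j'. u = (Inr i, Inr j) \<and> v = (Inr i', Inr j') \<and> (i + j) mod n = (i' + j') mod n)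
    \<or> (\<exists>i i' j. u = (Inl i, Inr j) \<and> v = (Inl i', Inr j))
    \<or> (\<exists>i j j'. u = (Inr i, Inl j) \<and> v = (Inr i, Inl j'))"
proof -
  \<comment> \<open>Latin colors lie below \<open>n\<close>, all others do not. The premise
    \<open>i < n\<close> ensures \<open>n > 0\<close>.\<close>
  have neq: "(i + j) mod n \<noteq> m" "m \<noteq> (i + j) mod n" if "n \<le> m" "i < n" for i j m
    using that mod_less_divisor[of n "i + j"] by linarith+
  show ?thesis
    using assms
    by (cases "(n, u)" rule: block_coloring.cases; cases "(n, v)" rule: block_coloring.cases)
      (simp_all add: cartesian_prod_def complete_bipartite_def image_iff mult_add_eq_iff neq)
qed

lemma nonrepetitive_block_coloring:
  "nonrepetitive (complete_bipartite n n \<box> complete_bipartite n n) (block_coloring n)"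
  (is "nonrepetitive ?G _")
proof (rule nonrepetitive_if_arc_colors_separated)
  have verts: "u \<in> pverts ?G \<and> v \<in> pverts ?G" if "(u, v) \<in> parcs ?G" for u v
    using that by (auto simp: cartesian_prod_def)
  \<comment> \<open>An arc switches the side of one coordinate, so it leaves its block, whereas
    equal colors occur only within a block.\<close>
  show "block_coloring n u \<noteq> block_coloring n v" if "(u, v) \<in> parcs ?G" for u v
    using that verts[OF that] block_coloring_eqD[of u n v]
    by (auto simp: cartesian_prod_def complete_bipartite_def)
  \<comment> \<open>An endpoint in the \<open>(Inl, Inl)\<close> block is fixed by its color. Any
    other arc joins a cell to a line vertex, whose color fixes the index it shares with the cell;
    \<open>add_mod_eq_iff\<close> then identifies the two cells.\<close>
  show "u = u' \<or> v = v'"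
    if "(u, v) \<in> parcs ?G" "(u', v') \<in> parcs ?G"
      "block_coloring n u = block_coloring n u'" "block_coloring n v = block_coloring n v'"
    for u v u' v'
    using block_coloring_eqD[of u n u'] block_coloring_eqD[of v n v'] verts[OF that(1)]
      verts[OF that(2)] that
    by (auto simp: cartesian_prod_def complete_bipartite_def add_mod_eq_iff)
qed

lemma nonrepetitive_number_complete_bipartite_prod_le:
  "nonrepetitive_number (complete_bipartite n n \<box> complete_bipartite n n) \<le> n\<^sup>2 + 3 * n"
proof -
  have "block_coloring n \<in> pverts (complete_bipartite n n \<box> complete_bipartite n n)
      \<rightarrow> {..<n\<^sup>2 + 3 * n}"
  proof
    fix u assume "u \<in> pverts (complete_bipartite n n \<box> complete_bipartite n n)"
    then show "block_coloring n u \<in> {..<n\<^sup>2 + 3 * n}"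
      by (cases "(n, u)" rule: block_coloring.cases)
        (auto simp: cartesian_prod_def complete_bipartite_def mult_add_less_square
          intro: less_le_trans[OF mod_less_divisor])
  qed
  then show ?thesis
    unfolding nonrepetitive_number_def using nonrepetitive_block_coloring
    by (intro Least_le) blast
qed

theorem theorem7:
  shows "limsup (\<lambda>n. ereal (real (nonrepetitive_number
             (complete_bipartite n n \<box> complete_bipartite n n)) / (real n)\<^sup>2)) \<le> ereal (3 / 2)"
proof (rule Limsup_bounded)
  \<comment> \<open>For positive \<open>n\<close>, \<open>3 * n\<close> is at most half of
    \<open>n\<^sup>2\<close> exactly from \<open>n = 6\<close> on.\<close>
  have "real (nonrepetitive_number (complete_bipartite n n \<box> complete_bipartite n n)) / (real n)\<^sup>2
      \<le> 3 / 2" if n: "n \<ge> 6" for n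
  proof -
    have "real (nonrepetitive_number (complete_bipartite n n \<box> complete_bipartite n n))
        \<le> real (n\<^sup>2 + 3 * n)"
      using nonrepetitive_number_complete_bipartite_prod_le by (intro of_nat_mono)
    also have "\<dots> \<le> 3 / 2 * (real n)\<^sup>2"
      using mult_right_mono[of 6 "real n" "real n"] n by (simp add: power2_eq_square)
    finally show ?thesis
      using n by (simp add: divide_le_eq)
  qed
  then show "\<forall>\<^sub>F n in sequentially. ereal (real (nonrepetitive_number
      (complete_bipartite n n \<box> complete_bipartite n n)) / (real n)\<^sup>2) \<le> ereal (3 / 2)"
    by (auto simp: eventually_sequentially)
qed

end
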